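(* Let $G$ be an abelian group, $k$ a field, and $c\in H^2(G,k^* )$, where $k^*$ has the trivial $G$-action. Then the ring $k[G,c]$ is commutative if and only if $c\in H^2_S(G,k^* )$.
   Context: Let $A$ be an abelian group (written additively) with trivial $G$-action. $Z^2(G,A)$ is the group of functions $\varphi:G\times G\to A$ with $\varphi(g,h)-\varphi(f+g,h)+\varphi(f,g+h)-\varphi(f,g)=0$ for all $f,g,h\in G$; $B^2(G,A)\subset Z^2(G,A)$ is the subgroup of functions $(f,g)\mapsto\beta(g)-\beta(f+g)+\beta(f)$ with $\beta:G\to A$ any function; $H^2(G,A)=Z^2(G,A)/B^2(G,A)$. $Z^2_S(G,A)$ and $B^2_S(G,A)$ are the subgroups of those $\varphi$ in $Z^2(G,A)$, respectively $B^2(G,A)$, with $\varphi(g,h)=\varphi(h,g)$ for all $g,h$, and $H^2_S(G,A)=Z^2_S(G,A)/B^2_S(G,A)$, viewed as a subgroup of $H^2(G,A)$. Here $A=k^*$ is the multiplicative group of $k$. For $c\in H^2(G,k^* )$ represented by $\tilde c\in Z^2(G,k^* )$, $k[G,c]$ is the (associative unital, not necessarily commutative) $G$-graded $k$-algebra $\bigoplus_{g\in G}kx_g$ with $k$-bilinear multiplication determined by $x_gx_h=\tilde c(g,h)x_{g+h}$; up to isomorphism of $G$-graded rings it depends only on $c$. *)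

theory Defs
  imports "HOL-Algebra.Algebra"
begin

text \<open>
  The groups \<open>G\<close> and \<open>A\<close> are written multiplicatively, as usual in HOL-Algebra.
  Functions \<open>G \<times> G \<rightarrow> A\<close> are represented by extensional functions on
  \<open>carrier G \<times> carrier G\<close>, so that distinct elements of the groups below are
  distinct functions in the mathematical sense.
\<close>

definition C2 :: "('g, 'm) monoid_scheme \<Rightarrow> ('a, 'n) monoid_scheme \<Rightarrow> ('g \<times> 'g \<Rightarrow> 'a) monoid"
  where "C2 G A = product_group (carrier G \<times> carrier G) (\<lambda>_. A)"

definition Z2 :: "('g, 'm) monoid_scheme \<Rightarrow> ('a, 'n) monoid_scheme \<Rightarrow> ('g \<times> 'g \<Rightarrow> 'a) set"
  where "Z2 G A = {\<phi> \<in> carrier (C2 G A).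
    \<forall>f\<in>carrier G. \<forall>g\<in>carrier G. \<forall>h\<in>carrier G.
      \<phi> (g, h) \<otimes>\<^bsub>A\<^esub> inv\<^bsub>A\<^esub> \<phi> (f \<otimes>\<^bsub>G\<^esub> g, h) \<otimes>\<^bsub>A\<^esub> \<phi> (f, g \<otimes>\<^bsub>G\<^esub> h) \<otimes>\<^bsub>A\<^esub> inv\<^bsub>A\<^esub> \<phi> (f, g) = \<one>\<^bsub>A\<^esub>}"

definition coboundary ::
    "('g, 'm) monoid_scheme \<Rightarrow> ('a, 'n) monoid_scheme \<Rightarrow> ('g \<Rightarrow> 'a) \<Rightarrow> 'g \<times> 'g \<Rightarrow> 'a"
  where "coboundary G A \<beta> = (\<lambda>(f, g)\<in>carrier G \<times> carrier G.
    \<beta> g \<otimes>\<^bsub>A\<^esub> inv\<^bsub>A\<^esub> \<beta> (f \<otimes>\<^bsub>G\<^esub> g) \<otimes>\<^bsub>A\<^esub> \<beta> f)"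

definition B2 :: "('g, 'm) monoid_scheme \<Rightarrow> ('a, 'n) monoid_scheme \<Rightarrow> ('g \<times> 'g \<Rightarrow> 'a) set"
  where "B2 G A = coboundary G A ` (carrier G \<rightarrow> carrier A)"

definition H2 :: "('g, 'm) monoid_scheme \<Rightarrow> ('a, 'n) monoid_scheme \<Rightarrow> ('g \<times> 'g \<Rightarrow> 'a) set monoid"
  where "H2 G A = (C2 G A)\<lparr>carrier := Z2 G A\<rparr> Mod B2 G A"

definition symmetric_cochain :: "('g, 'm) monoid_scheme \<Rightarrow> ('g \<times> 'g \<Rightarrow> 'a) \<Rightarrow> bool"
  where "symmetric_cochain G \<phi> \<longleftrightarrow> (\<forall>g\<in>carrier G. \<forall>h\<in>carrier G. \<phi> (g, h) = \<phi> (h, g))"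

definition Z2S :: "('g, 'm) monoid_scheme \<Rightarrow> ('a, 'n) monoid_scheme \<Rightarrow> ('g \<times> 'g \<Rightarrow> 'a) set"
  where "Z2S G A = {\<phi> \<in> Z2 G A. symmetric_cochain G \<phi>}"

definition B2S :: "('g, 'm) monoid_scheme \<Rightarrow> ('a, 'n) monoid_scheme \<Rightarrow> ('g \<times> 'g \<Rightarrow> 'a) set"
  where "B2S G A = {\<phi> \<in> B2 G A. symmetric_cochain G \<phi>}"

definition H2S :: "('g, 'm) monoid_scheme \<Rightarrow> ('a, 'n) monoid_scheme \<Rightarrow> ('g \<times> 'g \<Rightarrow> 'a) set monoid"
  where "H2S G A = (C2 G A)\<lparr>carrier := Z2S G A\<rparr> Mod B2S G A"

text \<open>
  As \<open>G\<close> is abelian, every coboundary is symmetric. So a coset of \<open>B2S\<close> is literally a coset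
  of \<open>B2\<close>, and \<open>H2S\<close> is a subgroup of \<open>H2\<close> without any identification map
  (lemma \<open>subgroup_H2S\<close>).
\<close>

context
  fixes G :: "('g, 'm) monoid_scheme" and A :: "('a, 'n) monoid_scheme"
  assumes G: "comm_group G" and A: "comm_group A"
begin

interpretation G: comm_group G by (rule G)
interpretation A: comm_group A by (rule A)

lemma comm_group_C2: "comm_group (C2 G A)"
  by (auto simp: C2_def PiE_iff A.m_comm A.is_group intro!: group.group_comm_groupI restrict_ext)

lemma C2_mem: "\<phi> \<in> carrier (C2 G A) \<Longrightarrow> g \<in> carrier G \<Longrightarrow> h \<in> carrier G \<Longrightarrow> \<phi> (g, h) \<in> carrier A"
  by (auto simp: C2_def PiE_iff)

lemma C2_mult: "g \<in> carrier G \<Longrightarrow> h \<in> carrier G \<Longrightarrow>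
    (\<phi> \<otimes>\<^bsub>C2 G A\<^esub> \<psi>) (g, h) = \<phi> (g, h) \<otimes>\<^bsub>A\<^esub> \<psi> (g, h)"
  by (simp add: C2_def)

lemma C2_inv: "\<phi> \<in> carrier (C2 G A) \<Longrightarrow> g \<in> carrier G \<Longrightarrow> h \<in> carrier G \<Longrightarrow>
    (inv\<^bsub>C2 G A\<^esub> \<phi>) (g, h) = inv\<^bsub>A\<^esub> \<phi> (g, h)"
  by (simp add: C2_def A.is_group)

lemma C2_one: "g \<in> carrier G \<Longrightarrow> h \<in> carrier G \<Longrightarrow> \<one>\<^bsub>C2 G A\<^esub> (g, h) = \<one>\<^bsub>A\<^esub>"
  by (simp add: C2_def)

lemma Z2_iff: "\<phi> \<in> Z2 G A \<longleftrightarrow> \<phi> \<in> carrier (C2 G A) \<and>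
    (\<forall>f\<in>carrier G. \<forall>g\<in>carrier G. \<forall>h\<in>carrier G.
      \<phi> (g, h) \<otimes>\<^bsub>A\<^esub> \<phi> (f, g \<otimes>\<^bsub>G\<^esub> h) = \<phi> (f, g) \<otimes>\<^bsub>A\<^esub> \<phi> (f \<otimes>\<^bsub>G\<^esub> g, h))"
proof -
  have *: "a \<otimes>\<^bsub>A\<^esub> inv\<^bsub>A\<^esub> b \<otimes>\<^bsub>A\<^esub> c \<otimes>\<^bsub>A\<^esub> inv\<^bsub>A\<^esub> d = \<one>\<^bsub>A\<^esub> \<longleftrightarrow> a \<otimes>\<^bsub>A\<^esub> c = d \<otimes>\<^bsub>A\<^esub> b"
    if "a \<in> carrier A" "b \<in> carrier A" "c \<in> carrier A" "d \<in> carrier A" for a b c d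
  proof -
    have "a \<otimes>\<^bsub>A\<^esub> inv\<^bsub>A\<^esub> b \<otimes>\<^bsub>A\<^esub> c \<otimes>\<^bsub>A\<^esub> inv\<^bsub>A\<^esub> d = (a \<otimes>\<^bsub>A\<^esub> c) \<otimes>\<^bsub>A\<^esub> inv\<^bsub>A\<^esub> (d \<otimes>\<^bsub>A\<^esub> b)"
      using that by (simp add: A.inv_mult A.m_ac)
    then show ?thesis
      using that A.right_cancel[of "inv\<^bsub>A\<^esub> (d \<otimes>\<^bsub>A\<^esub> b)" "a \<otimes>\<^bsub>A\<^esub> c" "d \<otimes>\<^bsub>A\<^esub> b"] by (simp add: A.r_inv)
  qed
  show ?thesis
    unfolding Z2_def by (auto simp: * C2_mem)
qed

lemma subgroup_Z2: "subgroup (Z2 G A) (C2 G A)"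
proof -
  interpret C: comm_group "C2 G A" by (rule comm_group_C2)
  show ?thesis
  proof (rule C.subgroupI)
    show "Z2 G A \<subseteq> carrier (C2 G A)" by (auto simp: Z2_def)
    have "\<one>\<^bsub>C2 G A\<^esub> \<in> Z2 G A" by (simp add: Z2_iff C2_one)
    then show "Z2 G A \<noteq> {}" by blast
    fix a assume a: "a \<in> Z2 G A"
    show "inv\<^bsub>C2 G A\<^esub> a \<in> Z2 G A"
      using a by (auto simp: Z2_iff C2_inv C2_mem simp flip: A.inv_mult)
    fix b assume b: "b \<in> Z2 G A"
    have *: "(p \<otimes>\<^bsub>A\<^esub> q) \<otimes>\<^bsub>A\<^esub> (r \<otimes>\<^bsub>A\<^esub> s) = (p \<otimes>\<^bsub>A\<^esub> r) \<otimes>\<^bsub>A\<^esub> (q \<otimes>\<^bsub>A\<^esub> s)"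
      if "p \<in> carrier A" "q \<in> carrier A" "r \<in> carrier A" "s \<in> carrier A" for p q r s
      using that by (simp add: A.m_ac)
    have ab: "a \<in> carrier (C2 G A)" "b \<in> carrier (C2 G A)" using a b by (simp_all add: Z2_iff)
    have "a (g, h) \<otimes>\<^bsub>A\<^esub> b (g, h) \<otimes>\<^bsub>A\<^esub> (a (f, g \<otimes>\<^bsub>G\<^esub> h) \<otimes>\<^bsub>A\<^esub> b (f, g \<otimes>\<^bsub>G\<^esub> h)) =
        a (f, g) \<otimes>\<^bsub>A\<^esub> b (f, g) \<otimes>\<^bsub>A\<^esub> (a (f \<otimes>\<^bsub>G\<^esub> g, h) \<otimes>\<^bsub>A\<^esub> b (f \<otimes>\<^bsub>G\<^esub> g, h))"
      if "f \<in> carrier G" "g \<in> carrier G" "h \<in> carrier G" for f g h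
    proof -
      have mem: "a (x, y) \<in> carrier A" "b (x, y) \<in> carrier A" if "x \<in> carrier G" "y \<in> carrier G" for x y
        using that ab by (auto intro: C2_mem)
      have "a (g, h) \<otimes>\<^bsub>A\<^esub> a (f, g \<otimes>\<^bsub>G\<^esub> h) = a (f, g) \<otimes>\<^bsub>A\<^esub> a (f \<otimes>\<^bsub>G\<^esub> g, h)"
        "b (g, h) \<otimes>\<^bsub>A\<^esub> b (f, g \<otimes>\<^bsub>G\<^esub> h) = b (f, g) \<otimes>\<^bsub>A\<^esub> b (f \<otimes>\<^bsub>G\<^esub> g, h)"
        using a b that by (simp_all add: Z2_iff)
      then show ?thesis
        by (subst (1 2) *) (simp_all add: mem that)
    qed
    then show "a \<otimes>\<^bsub>C2 G A\<^esub> b \<in> Z2 G A"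
      using ab by (simp add: Z2_iff C2_mult)
  qed
qed

lemma subgroup_Z2S: "subgroup (Z2S G A) (C2 G A)"
proof -
  interpret C: comm_group "C2 G A" by (rule comm_group_C2)
  show ?thesis
  proof (rule C.subgroupI)
    show "Z2S G A \<subseteq> carrier (C2 G A)" by (auto simp: Z2S_def Z2_def)
    have "\<one>\<^bsub>C2 G A\<^esub> \<in> Z2S G A"
      using subgroup.one_closed[OF subgroup_Z2] by (simp add: Z2S_def symmetric_cochain_def C2_one)
    then show "Z2S G A \<noteq> {}" by blast
    fix a assume a: "a \<in> Z2S G A"
    then have aC: "a \<in> carrier (C2 G A)" by (simp add: Z2S_def Z2_def)
    show "inv\<^bsub>C2 G A\<^esub> a \<in> Z2S G A"
      using a subgroup.m_inv_closed[OF subgroup_Z2, of a]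
      by (simp add: Z2S_def symmetric_cochain_def C2_inv[OF aC])
    fix b assume b: "b \<in> Z2S G A"
    show "a \<otimes>\<^bsub>C2 G A\<^esub> b \<in> Z2S G A"
      using a b subgroup.m_closed[OF subgroup_Z2, of a b]
      by (simp add: Z2S_def symmetric_cochain_def C2_mult)
  qed
qed

lemma coboundary_apply: "f \<in> carrier G \<Longrightarrow> g \<in> carrier G \<Longrightarrow>
    coboundary G A \<beta> (f, g) = \<beta> g \<otimes>\<^bsub>A\<^esub> inv\<^bsub>A\<^esub> \<beta> (f \<otimes>\<^bsub>G\<^esub> g) \<otimes>\<^bsub>A\<^esub> \<beta> f"
  by (simp add: coboundary_def)

lemma coboundary_C2: "\<beta> \<in> carrier G \<rightarrow> carrier A \<Longrightarrow> coboundary G A \<beta> \<in> carrier (C2 G A)"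
  by (auto simp: coboundary_def C2_def Pi_iff)

lemma C2_eqI:
  assumes "\<phi> \<in> carrier (C2 G A)" "\<psi> \<in> carrier (C2 G A)"
    "\<And>f g. f \<in> carrier G \<Longrightarrow> g \<in> carrier G \<Longrightarrow> \<phi> (f, g) = \<psi> (f, g)"
  shows "\<phi> = \<psi>"
proof (rule PiE_ext)
  show "\<phi> \<in> carrier G \<times> carrier G \<rightarrow>\<^sub>E carrier A" "\<psi> \<in> carrier G \<times> carrier G \<rightarrow>\<^sub>E carrier A"
    using assms(1,2) by (simp_all add: C2_def)
qed (use assms(3) in auto)

lemma coboundary_Z2: assumes b: "\<beta> \<in> carrier G \<rightarrow> carrier A" shows "coboundary G A \<beta> \<in> Z2 G A"
proof -
  have c: "\<beta> x \<in> carrier A" if "x \<in> carrier G" for x using b that by auto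
  have *: "(h \<otimes>\<^bsub>A\<^esub> i \<otimes>\<^bsub>A\<^esub> g) \<otimes>\<^bsub>A\<^esub> (gh \<otimes>\<^bsub>A\<^esub> j \<otimes>\<^bsub>A\<^esub> f) =
      (g \<otimes>\<^bsub>A\<^esub> k \<otimes>\<^bsub>A\<^esub> f) \<otimes>\<^bsub>A\<^esub> (h \<otimes>\<^bsub>A\<^esub> j \<otimes>\<^bsub>A\<^esub> fg)"
    if "f \<in> carrier A" "g \<in> carrier A" "h \<in> carrier A" "j \<in> carrier A" "fg \<in> carrier A"
      "gh \<in> carrier A" "i = inv\<^bsub>A\<^esub> gh" "k = inv\<^bsub>A\<^esub> fg" for f g h i j k fg gh
  proof -
    have ik: "i \<in> carrier A" "k \<in> carrier A" "gh \<otimes>\<^bsub>A\<^esub> i = \<one>\<^bsub>A\<^esub>" "fg \<otimes>\<^bsub>A\<^esub> k = \<one>\<^bsub>A\<^esub>"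
      using that by (simp_all add: A.r_inv)
    note that = that(1-6) ik(1,2)
    have "(h \<otimes>\<^bsub>A\<^esub> i \<otimes>\<^bsub>A\<^esub> g) \<otimes>\<^bsub>A\<^esub> (gh \<otimes>\<^bsub>A\<^esub> j \<otimes>\<^bsub>A\<^esub> f) = (gh \<otimes>\<^bsub>A\<^esub> i) \<otimes>\<^bsub>A\<^esub> (h \<otimes>\<^bsub>A\<^esub> (g \<otimes>\<^bsub>A\<^esub> (j \<otimes>\<^bsub>A\<^esub> f)))"
      using that by (simp add: A.m_ac)
    also have "\<dots> = (fg \<otimes>\<^bsub>A\<^esub> k) \<otimes>\<^bsub>A\<^esub> (h \<otimes>\<^bsub>A\<^esub> (g \<otimes>\<^bsub>A\<^esub> (j \<otimes>\<^bsub>A\<^esub> f)))"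
      by (simp add: ik(3,4))
    also have "\<dots> = (g \<otimes>\<^bsub>A\<^esub> k \<otimes>\<^bsub>A\<^esub> f) \<otimes>\<^bsub>A\<^esub> (h \<otimes>\<^bsub>A\<^esub> j \<otimes>\<^bsub>A\<^esub> fg)"
      using that by (simp add: A.m_ac)
    finally show ?thesis .
  qed
  show ?thesis
    unfolding Z2_iff
    by (auto simp: coboundary_C2[OF b] coboundary_apply c G.m_assoc intro!: *)
qed

lemma subgroup_B2: "subgroup (B2 G A) (C2 G A)"
proof -
  interpret C: comm_group "C2 G A" by (rule comm_group_C2)
  show ?thesis
  proof (rule C.subgroupI)
    show "B2 G A \<subseteq> carrier (C2 G A)" by (auto simp: B2_def coboundary_C2)
    have "(\<lambda>_. \<one>\<^bsub>A\<^esub>) \<in> carrier G \<rightarrow> carrier A" by simp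
    then show "B2 G A \<noteq> {}" by (auto simp: B2_def)
    fix a assume "a \<in> B2 G A"
    then obtain \<beta> where \<beta>: "\<beta> \<in> carrier G \<rightarrow> carrier A" and a: "a = coboundary G A \<beta>"
      by (auto simp: B2_def)
    have 1: "(\<lambda>x. inv\<^bsub>A\<^esub> \<beta> x) \<in> carrier G \<rightarrow> carrier A" using \<beta> by auto
    have "inv\<^bsub>C2 G A\<^esub> a = coboundary G A (\<lambda>x. inv\<^bsub>A\<^esub> \<beta> x)"
      using \<beta> unfolding a
      by (intro C2_eqI) (auto simp: coboundary_C2 1 C2_inv coboundary_apply A.inv_mult Pi_iff A.m_ac)
    then show "inv\<^bsub>C2 G A\<^esub> a \<in> B2 G A" using 1 by (auto simp: B2_def)
    fix b assume "b \<in> B2 G A"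
    then obtain \<gamma> where \<gamma>: "\<gamma> \<in> carrier G \<rightarrow> carrier A" and b: "b = coboundary G A \<gamma>"
      by (auto simp: B2_def)
    have 2: "(\<lambda>x. \<beta> x \<otimes>\<^bsub>A\<^esub> \<gamma> x) \<in> carrier G \<rightarrow> carrier A" using \<beta> \<gamma> by auto
    have "a \<otimes>\<^bsub>C2 G A\<^esub> b = coboundary G A (\<lambda>x. \<beta> x \<otimes>\<^bsub>A\<^esub> \<gamma> x)"
      using \<beta> \<gamma> unfolding a b
      by (intro C2_eqI) (auto simp: coboundary_C2 2 C2_mult coboundary_apply A.inv_mult Pi_iff A.m_ac)
    then show "a \<otimes>\<^bsub>C2 G A\<^esub> b \<in> B2 G A" using 2 by (auto simp: B2_def)
  qed
qed

lemma B2_subset_Z2: "B2 G A \<subseteq> Z2 G A"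
  by (auto simp: B2_def coboundary_Z2)

lemma B2S_eq_B2: "B2S G A = B2 G A"
  by (auto simp: B2S_def B2_def symmetric_cochain_def coboundary_apply Pi_iff G.m_comm A.m_ac)

lemma comm_group_Z2: "comm_group ((C2 G A)\<lparr>carrier := Z2 G A\<rparr>)"
proof -
  interpret C: comm_group "C2 G A" by (rule comm_group_C2)
  show ?thesis
    using subgroup.subset[OF subgroup_Z2]
    by (intro group.group_comm_groupI subgroup.subgroup_is_group[OF subgroup_Z2 C.is_group])
      (auto intro: C.m_comm)
qed

lemma comm_group_H2: "comm_group (H2 G A)"
  unfolding H2_def
proof (rule comm_group.abelian_FactGroup)
  interpret C: comm_group "C2 G A" by (rule comm_group_C2)
  show "comm_group ((C2 G A)\<lparr>carrier := Z2 G A\<rparr>)"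
    by (rule comm_group_Z2)
  show "subgroup (B2 G A) ((C2 G A)\<lparr>carrier := Z2 G A\<rparr>)"
    by (rule C.subgroup_incl[OF subgroup_B2 subgroup_Z2 B2_subset_Z2])
qed

lemma subgroup_H2S: "subgroup (carrier (H2S G A)) (H2 G A)"
  and H2S_eq: "H2S G A = (H2 G A)\<lparr>carrier := carrier (H2S G A)\<rparr>"
proof -
  interpret C: comm_group "C2 G A" by (rule comm_group_C2)
  let ?Z = "(C2 G A)\<lparr>carrier := Z2 G A\<rparr>"
  have Z: "comm_group ?Z"
    by (rule comm_group_Z2)
  have B: "subgroup (B2 G A) ?Z"
    by (rule C.subgroup_incl[OF subgroup_B2 subgroup_Z2 B2_subset_Z2])
  interpret Z: comm_group ?Z by (rule Z)
  interpret N: normal "B2 G A" ?Z using B by (simp add: Z.normal_iff_subgroup)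
  have ZS: "subgroup (Z2S G A) ?Z"
    by (rule C.subgroup_incl[OF subgroup_Z2S subgroup_Z2]) (auto simp: Z2S_def)
  have hom: "group_hom ?Z (H2 G A) (\<lambda>a. B2 G A #>\<^bsub>?Z\<^esub> a)"
    unfolding H2_def using N.r_coset_hom_Mod N.factorgroup_is_group Z.is_group
    by (intro group_hom.intro group_hom_axioms.intro) 
  have eq: "carrier (H2S G A) = (\<lambda>a. B2 G A #>\<^bsub>?Z\<^esub> a) ` Z2S G A"
    by (simp add: H2S_def carrier_FactGroup B2S_eq_B2 r_coset_def)
  show "subgroup (carrier (H2S G A)) (H2 G A)"
    unfolding eq by (rule group_hom.subgroup_img_is_subgroup[OF hom ZS])
  show "H2S G A = (H2 G A)\<lparr>carrier := carrier (H2S G A)\<rparr>"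
    by (simp add: H2S_def H2_def FactGroup_def B2S_eq_B2 set_mult_def[abs_def])
qed

end

text \<open>
  \<open>k[G,c]\<close> for a cocycle \<open>\<phi>\<close> representing \<open>c\<close>: the additive group is the direct sum
  \<open>\<Oplus>\<^sub>g K x\<^sub>g\<close>, an element \<open>\<Sum>\<^sub>g a\<^sub>g x\<^sub>g\<close> being the finitely supported function \<open>g \<mapsto> a\<^sub>g\<close>, and
  the product is the bilinear extension of \<open>x\<^sub>g x\<^sub>h = \<phi>(g,h) x\<^sub>g\<^sub>h\<close>. Cocycles are not required to be
  normalized, so the unit is \<open>\<phi>(1,1)\<^sup>-\<^sup>1 x\<^sub>1\<close> rather than \<open>x\<^sub>1\<close>.
\<close>

definition twisted_group_ring ::
    "('k, 'n) ring_scheme \<Rightarrow> ('g, 'm) monoid_scheme \<Rightarrow> ('g \<times> 'g \<Rightarrow> 'k) \<Rightarrow> ('g \<Rightarrow> 'k) ring"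
  where "twisted_group_ring K G \<phi> =
    (let S = sum_group (carrier G) (\<lambda>_. add_monoid K) in
    \<lparr>carrier = carrier S,
     monoid.mult = (\<lambda>a b. \<lambda>s\<in>carrier G.
       finsum K (\<lambda>(g, h). a g \<otimes>\<^bsub>K\<^esub> b h \<otimes>\<^bsub>K\<^esub> \<phi> (g, h))
         {(g, h) \<in> carrier G \<times> carrier G. a g \<noteq> \<zero>\<^bsub>K\<^esub> \<and> b h \<noteq> \<zero>\<^bsub>K\<^esub> \<and> g \<otimes>\<^bsub>G\<^esub> h = s}),
     monoid.one = (\<lambda>s\<in>carrier G. if s = \<one>\<^bsub>G\<^esub> then inv\<^bsub>K\<^esub> \<phi> (\<one>\<^bsub>G\<^esub>, \<one>\<^bsub>G\<^esub>) else \<zero>\<^bsub>K\<^esub>),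
     ring.zero = \<one>\<^bsub>S\<^esub>,
     ring.add = (\<otimes>\<^bsub>S\<^esub>)\<rparr>)"

definition monomial ::
    "('k, 'n) ring_scheme \<Rightarrow> ('g, 'm) monoid_scheme \<Rightarrow> 'k \<Rightarrow> 'g \<Rightarrow> 'g \<Rightarrow> 'k"
  where "monomial K G r g = (\<lambda>s\<in>carrier G. if s = g then r else \<zero>\<^bsub>K\<^esub>)"

lemma monomial_closed:
  assumes "field K" "g \<in> carrier G" "r \<in> carrier K"
  shows "monomial K G r g \<in> carrier (twisted_group_ring K G \<phi>)"
proof -
  interpret field K by fact
  have "finite {i \<in> carrier G. monomial K G r g i \<noteq> \<zero>\<^bsub>K\<^esub>}"
    by (rule finite_subset[of _ "{g}"]) (auto simp: monomial_def)
  then show ?thesis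
    using assms by (auto simp: twisted_group_ring_def carrier_sum_group add.is_group monomial_def)
qed

lemma monomial_mult:
  assumes "group G" "field K" and gh: "g \<in> carrier G" "h \<in> carrier G"
    and rt: "r \<in> carrier K" "t \<in> carrier K" "\<phi> (g, h) \<in> carrier K"
  shows "monomial K G r g \<otimes>\<^bsub>twisted_group_ring K G \<phi>\<^esub> monomial K G t h =
    monomial K G (r \<otimes>\<^bsub>K\<^esub> t \<otimes>\<^bsub>K\<^esub> \<phi> (g, h)) (g \<otimes>\<^bsub>G\<^esub> h)"
proof -
  interpret G: group G by fact
  interpret field K by fact
  let ?S = "\<lambda>s. {(g', h') \<in> carrier G \<times> carrier G. monomial K G r g g' \<noteq> \<zero>\<^bsub>K\<^esub> \<and>
    monomial K G t h h' \<noteq> \<zero>\<^bsub>K\<^esub> \<and> g' \<otimes>\<^bsub>G\<^esub> h' = s}"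
  have S: "?S s = (if r \<noteq> \<zero>\<^bsub>K\<^esub> \<and> t \<noteq> \<zero>\<^bsub>K\<^esub> \<and> s = g \<otimes>\<^bsub>G\<^esub> h then {(g, h)} else {})" for s
    using gh by (auto simp: monomial_def split: if_splits)
  show ?thesis
    unfolding twisted_group_ring_def Let_def monoid.simps S
    using gh rt by (auto simp: monomial_def restrict_def fun_eq_iff)
qed

lemma one_twisted_group_ring:
  "\<one>\<^bsub>twisted_group_ring K G \<phi>\<^esub> = monomial K G (inv\<^bsub>K\<^esub> \<phi> (\<one>\<^bsub>G\<^esub>, \<one>\<^bsub>G\<^esub>)) \<one>\<^bsub>G\<^esub>"
  by (simp add: twisted_group_ring_def monomial_def Let_def)

end

theory Submission
  imports Defs
begin

text \<open>
  Evaluating \<open>x\<^sub>g x\<^sub>h = x\<^sub>h x\<^sub>g\<close> at \<open>gh = hg\<close> gives \<open>\<phi>(g,h) = \<phi>(h,g)\<close>, so commutativity of the ring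
  says exactly that \<open>\<phi>\<close> is symmetric. As coboundaries are symmetric, this property does not depend
  on the representative \<open>\<phi>\<close> of \<open>c\<close>. The ring axioms for \<open>k[G,c]\<close> are checked on the formula
  \<open>(ab)(s) = \<Sum>\<^sub>g a(g) b(g\<^sup>-\<^sup>1s) \<phi>(g, g\<^sup>-\<^sup>1s)\<close>.
\<close>

text \<open>Induction on \<open>A\<close>, splitting off one factor under the product over
  \<open>B\<close>. For infinite \<open>B\<close> both sides collapse to the default value \<one> of
  \<open>finprod\<close>. Applied to the additive monoid of \<open>K\<close>, it exchanges the
  double sum in the associativity proof.\<close>

lemma (in comm_monoid) finprod_swap:
  assumes "finite A" and "\<And>i j. i \<in> A \<Longrightarrow> j \<in> B \<Longrightarrow> f i j \<in> carrier G"
  shows "(\<Otimes>i\<in>A. \<Otimes>j\<in>B. f i j) = (\<Otimes>j\<in>B. \<Otimes>i\<in>A. f i j)"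
  using assms
proof (induction A)
  case empty
  then show ?case by simp
next
  case (insert x A)
  have "(\<Otimes>j\<in>B. \<Otimes>i\<in>insert x A. f i j) = (\<Otimes>j\<in>B. f x j \<otimes> (\<Otimes>i\<in>A. f i j))"
    using insert by (intro finprod_cong') (auto simp: Pi_iff)
  also have "\<dots> = (\<Otimes>j\<in>B. f x j) \<otimes> (\<Otimes>j\<in>B. \<Otimes>i\<in>A. f i j)"
    using insert by (intro finprod_multf) (auto simp: Pi_iff)
  finally show ?case
    using insert by (simp add: Pi_iff)
qed

section \<open>Twisted group ring of a factor set: coefficients and addition\<close>

text \<open>The values of \<open>\<phi>\<close> are regarded as elements of \<open>K\<close> that
  happen to be units, and the cocycle identity is stated without inverses, so that both can be used
  directly in ring computations with coefficients.\<close>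

locale factor_set = G: group G + K: cring K
  for G :: "('g, 'm) monoid_scheme" and K :: "('k, 'n) ring_scheme" +
  fixes \<phi> :: "'g \<times> 'g \<Rightarrow> 'k"
  assumes Units_factor [simp]: "g \<in> carrier G \<Longrightarrow> h \<in> carrier G \<Longrightarrow> \<phi> (g, h) \<in> Units K"
    and cocycle: "f \<in> carrier G \<Longrightarrow> g \<in> carrier G \<Longrightarrow> h \<in> carrier G \<Longrightarrow>
      \<phi> (g, h) \<otimes>\<^bsub>K\<^esub> \<phi> (f, g \<otimes>\<^bsub>G\<^esub> h) = \<phi> (f, g) \<otimes>\<^bsub>K\<^esub> \<phi> (f \<otimes>\<^bsub>G\<^esub> g, h)"
begin

abbreviation "R \<equiv> twisted_group_ring K G \<phi>"
abbreviation "supp a \<equiv> {g \<in> carrier G. a g \<noteq> \<zero>\<^bsub>K\<^esub>}"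

lemma factor_closed [simp]: "g \<in> carrier G \<Longrightarrow> h \<in> carrier G \<Longrightarrow> \<phi> (g, h) \<in> carrier K"
  by (simp add: K.Units_closed)

lemma inv_solve [simp]: "g \<in> carrier G \<Longrightarrow> s \<in> carrier G \<Longrightarrow> g \<otimes>\<^bsub>G\<^esub> (inv\<^bsub>G\<^esub> g \<otimes>\<^bsub>G\<^esub> s) = s"
  "g \<in> carrier G \<Longrightarrow> s \<in> carrier G \<Longrightarrow> inv\<^bsub>G\<^esub> g \<otimes>\<^bsub>G\<^esub> (g \<otimes>\<^bsub>G\<^esub> s) = s"
  by (simp_all flip: G.m_assoc)

lemma carrier_iff: "a \<in> carrier R \<longleftrightarrow> a \<in> carrier G \<rightarrow>\<^sub>E carrier K \<and> finite (supp a)"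
  by (simp add: twisted_group_ring_def carrier_sum_group K.add.is_group)

lemma coeff_closed [simp]: "a \<in> carrier R \<Longrightarrow> g \<in> carrier G \<Longrightarrow> a g \<in> carrier K"
  by (auto simp: carrier_iff)

lemma finite_supp: "a \<in> carrier R \<Longrightarrow> finite (supp a)"
  by (simp add: carrier_iff)

lemma twisted_eqI:
  assumes "a \<in> carrier R" "b \<in> carrier R" "\<And>s. s \<in> carrier G \<Longrightarrow> a s = b s"
  shows "a = b"
  using assms by (intro PiE_ext[of a "carrier G" "\<lambda>_. carrier K" b]) (auto simp: carrier_iff)

lemma add_apply [simp]: "s \<in> carrier G \<Longrightarrow> (a \<oplus>\<^bsub>R\<^esub> b) s = a s \<oplus>\<^bsub>K\<^esub> b s"
  by (simp add: twisted_group_ring_def)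

lemma one_apply: "s \<in> carrier G \<Longrightarrow>
    \<one>\<^bsub>R\<^esub> s = (if s = \<one>\<^bsub>G\<^esub> then inv\<^bsub>K\<^esub> \<phi> (\<one>\<^bsub>G\<^esub>, \<one>\<^bsub>G\<^esub>) else \<zero>\<^bsub>K\<^esub>)"
  by (simp add: twisted_group_ring_def)

text \<open>By construction the additive structure is the direct sum of copies of the additive group
  of \<open>K\<close>; commutativity is inherited coefficientwise.\<close>

lemma abelian_group_twisted: "abelian_group R"
proof (rule comm_group_abelian_groupI)
  let ?S = "sum_group (carrier G) (\<lambda>_. add_monoid K)"
  have "add_monoid R = ?S"
    by (simp add: twisted_group_ring_def Let_def del: one_sum_group mult_sum_group)
  moreover have "comm_group ?S"
  proof (rule group.group_comm_groupI)
    show "group ?S"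
      by (rule sum_group) (rule K.add.is_group)
    fix x y assume "x \<in> carrier ?S" "y \<in> carrier ?S"
    then show "x \<otimes>\<^bsub>?S\<^esub> y = y \<otimes>\<^bsub>?S\<^esub> x"
      by (auto simp: carrier_sum_group K.add.is_group PiE_iff intro!: restrict_ext K.a_comm)
  qed
  ultimately show "comm_group (add_monoid R)"
    by simp
qed

section \<open>The product as a sum over the left index\<close>

text \<open>In a group, a pair with product \<open>s\<close> is determined by its first entry
  \<open>g\<close>, the second being the inverse of \<open>g\<close> times \<open>s\<close>.
  Allowing any finite \<open>A\<close> above the support lets sums from different products be
  written over a common index set.\<close>

lemma mult_apply:
  assumes a: "a \<in> carrier R" and b: "b \<in> carrier R" and s: "s \<in> carrier G"
    and A: "finite A" "A \<subseteq> carrier G" "supp a \<subseteq> A"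
  shows "(a \<otimes>\<^bsub>R\<^esub> b) s = (\<Oplus>\<^bsub>K\<^esub>g\<in>A. a g \<otimes>\<^bsub>K\<^esub> b (inv\<^bsub>G\<^esub> g \<otimes>\<^bsub>G\<^esub> s) \<otimes>\<^bsub>K\<^esub> \<phi> (g, inv\<^bsub>G\<^esub> g \<otimes>\<^bsub>G\<^esub> s))"
proof -
  let ?S = "{(g, h) \<in> carrier G \<times> carrier G. a g \<noteq> \<zero>\<^bsub>K\<^esub> \<and> b h \<noteq> \<zero>\<^bsub>K\<^esub> \<and> g \<otimes>\<^bsub>G\<^esub> h = s}"
  let ?F = "\<lambda>(g, h). a g \<otimes>\<^bsub>K\<^esub> b h \<otimes>\<^bsub>K\<^esub> \<phi> (g, h)"
  define p where "p g = (g, inv\<^bsub>G\<^esub> g \<otimes>\<^bsub>G\<^esub> s)" for g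
  \<comment> \<open>The indices at which both coefficients are nonzero: \<open>p\<close> carries
    them bijectively onto the pairs in the definition of the product, and the terms of
    \<open>A\<close> left out are zero.\<close>
  define A' where "A' = {g \<in> A. a g \<noteq> \<zero>\<^bsub>K\<^esub> \<and> b (inv\<^bsub>G\<^esub> g \<otimes>\<^bsub>G\<^esub> s) \<noteq> \<zero>\<^bsub>K\<^esub>}"
  have S: "?S = p ` A'"
    using A s by (auto simp: p_def A'_def image_iff)
  have "(a \<otimes>\<^bsub>R\<^esub> b) s = finsum K ?F ?S"
    using s by (simp add: twisted_group_ring_def)
  also have "\<dots> = (\<Oplus>\<^bsub>K\<^esub>g\<in>A'. ?F (p g))"
    unfolding S using A s a b
    by (intro K.finsum_reindex) (auto simp: p_def A'_def inj_on_def)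
  also have "\<dots> = (\<Oplus>\<^bsub>K\<^esub>g\<in>A. ?F (p g))"
    using A s a b
    by (intro K.add.finprod_mono_neutral_cong_left) (auto simp: p_def A'_def subset_iff)
  finally show ?thesis
    by (simp add: p_def)
qed

text \<open>If the coefficient at \<open>s\<close> is nonzero, some term of
  \<open>mult_apply\<close> is nonzero, and its two indices multiply to \<open>s\<close>. The
  resulting finite bound gives closure under multiplication and an index set for
  associativity.\<close>

lemma supp_mult:
  assumes a: "a \<in> carrier R" and b: "b \<in> carrier R"
  shows "supp (a \<otimes>\<^bsub>R\<^esub> b) \<subseteq> (\<lambda>(g, h). g \<otimes>\<^bsub>G\<^esub> h) ` (supp a \<times> supp b)"
proof
  fix s assume s: "s \<in> supp (a \<otimes>\<^bsub>R\<^esub> b)"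
  have "\<exists>g\<in>supp a. b (inv\<^bsub>G\<^esub> g \<otimes>\<^bsub>G\<^esub> s) \<noteq> \<zero>\<^bsub>K\<^esub>"
  proof (rule ccontr)
    assume "\<not> ?thesis"
    then have "(a \<otimes>\<^bsub>R\<^esub> b) s = \<zero>\<^bsub>K\<^esub>"
      using s a by (subst mult_apply[OF a b _ finite_supp[OF a]]) (auto intro!: K.add.finprod_one_eqI)
    then show False using s by simp
  qed
  then obtain g where "g \<in> supp a" "b (inv\<^bsub>G\<^esub> g \<otimes>\<^bsub>G\<^esub> s) \<noteq> \<zero>\<^bsub>K\<^esub>" by blast
  then show "s \<in> (\<lambda>(g, h). g \<otimes>\<^bsub>G\<^esub> h) ` (supp a \<times> supp b)"
    using s by (intro image_eqI[of _ _ "(g, inv\<^bsub>G\<^esub> g \<otimes>\<^bsub>G\<^esub> s)"]) auto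
qed

lemma mult_closed:
  assumes a: "a \<in> carrier R" and b: "b \<in> carrier R"
  shows "a \<otimes>\<^bsub>R\<^esub> b \<in> carrier R"
proof -
  have "finite (supp (a \<otimes>\<^bsub>R\<^esub> b))"
    using finite_subset[OF supp_mult[OF a b]] finite_supp a b by blast
  moreover have "(a \<otimes>\<^bsub>R\<^esub> b) s \<in> carrier K" if "s \<in> carrier G" for s
    using that a b by (subst mult_apply[OF a b that finite_supp[OF a]]) (auto intro!: K.finsum_closed)
  moreover have "a \<otimes>\<^bsub>R\<^esub> b \<in> extensional (carrier G)"
    by (simp add: twisted_group_ring_def)
  ultimately show ?thesis
    by (simp add: carrier_iff PiE_iff)
qed

section \<open>The unit element for a cocycle that may fail to be normalized\<close>

text \<open>The cocycle identity at \<open>(1, 1, g)\<close> has the unit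
  \<open>\<phi> (1, g)\<close> on both sides, and cancelling it leaves the claim; the right-hand
  version uses \<open>(g, 1, 1)\<close>. This constancy is what makes the inverse of
  \<open>\<phi> (1, 1)\<close> the correct coefficient of the identity element.\<close>

lemma factor_one_left:
  assumes "g \<in> carrier G"
  shows "\<phi> (\<one>\<^bsub>G\<^esub>, g) = \<phi> (\<one>\<^bsub>G\<^esub>, \<one>\<^bsub>G\<^esub>)"
proof -
  have "\<phi> (\<one>\<^bsub>G\<^esub>, g) \<otimes>\<^bsub>K\<^esub> \<phi> (\<one>\<^bsub>G\<^esub>, g) = \<phi> (\<one>\<^bsub>G\<^esub>, g) \<otimes>\<^bsub>K\<^esub> \<phi> (\<one>\<^bsub>G\<^esub>, \<one>\<^bsub>G\<^esub>)"
    using cocycle[of "\<one>\<^bsub>G\<^esub>" "\<one>\<^bsub>G\<^esub>" g] assms by (simp add: K.m_comm)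
  then show ?thesis
    using assms by (simp add: K.Units_l_cancel)
qed

lemma factor_one_right:
  assumes "g \<in> carrier G"
  shows "\<phi> (g, \<one>\<^bsub>G\<^esub>) = \<phi> (\<one>\<^bsub>G\<^esub>, \<one>\<^bsub>G\<^esub>)"
proof -
  have "\<phi> (g, \<one>\<^bsub>G\<^esub>) \<otimes>\<^bsub>K\<^esub> \<phi> (g, \<one>\<^bsub>G\<^esub>) = \<phi> (g, \<one>\<^bsub>G\<^esub>) \<otimes>\<^bsub>K\<^esub> \<phi> (\<one>\<^bsub>G\<^esub>, \<one>\<^bsub>G\<^esub>)"
    using cocycle[of g "\<one>\<^bsub>G\<^esub>" "\<one>\<^bsub>G\<^esub>"] assms by (simp add: K.m_comm)
  then show ?thesis
    using assms by (simp add: K.Units_l_cancel)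
qed

lemma supp_one: "supp \<one>\<^bsub>R\<^esub> \<subseteq> {\<one>\<^bsub>G\<^esub>}"
  by (auto simp: one_apply split: if_splits)

lemma one_closed: "\<one>\<^bsub>R\<^esub> \<in> carrier R"
proof -
  have "\<one>\<^bsub>R\<^esub> \<in> extensional (carrier G)"
    by (simp add: twisted_group_ring_def)
  then show ?thesis
    using finite_subset[OF supp_one] by (auto simp: carrier_iff PiE_iff one_apply)
qed

lemma one_mult:
  assumes a: "a \<in> carrier R"
  shows "\<one>\<^bsub>R\<^esub> \<otimes>\<^bsub>R\<^esub> a = a"
proof (rule twisted_eqI)
  fix s assume s: "s \<in> carrier G"
  let ?u = "\<phi> (\<one>\<^bsub>G\<^esub>, \<one>\<^bsub>G\<^esub>)"
  have "(\<one>\<^bsub>R\<^esub> \<otimes>\<^bsub>R\<^esub> a) s = inv\<^bsub>K\<^esub> ?u \<otimes>\<^bsub>K\<^esub> a s \<otimes>\<^bsub>K\<^esub> ?u"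
    using s a supp_one
    by (subst mult_apply[OF one_closed a s, of "{\<one>\<^bsub>G\<^esub>}"]) (simp_all add: one_apply factor_one_left[OF s])
  also have "\<dots> = (inv\<^bsub>K\<^esub> ?u \<otimes>\<^bsub>K\<^esub> ?u) \<otimes>\<^bsub>K\<^esub> a s"
    using s a by (simp add: K.m_ac)
  finally show "(\<one>\<^bsub>R\<^esub> \<otimes>\<^bsub>R\<^esub> a) s = a s"
    using s a by simp
qed (use a in \<open>simp_all add: mult_closed one_closed\<close>)

lemma mult_one:
  assumes a: "a \<in> carrier R"
  shows "a \<otimes>\<^bsub>R\<^esub> \<one>\<^bsub>R\<^esub> = a"
proof (rule twisted_eqI)
  fix s assume s: "s \<in> carrier G"
  let ?u = "\<phi> (\<one>\<^bsub>G\<^esub>, \<one>\<^bsub>G\<^esub>)"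
  have *: "inv\<^bsub>G\<^esub> g \<otimes>\<^bsub>G\<^esub> s = \<one>\<^bsub>G\<^esub> \<longleftrightarrow> g = s" if "g \<in> carrier G" for g
    using that s by (metis G.inv_closed G.inv_equality G.inv_inv G.l_inv)
  \<comment> \<open>Only \<open>g = s\<close> can contribute, since the unit is supported at the
    identity of \<open>G\<close>. Inserting \<open>s\<close> guarantees that this term is present
    even when \<open>a s\<close> is zero.\<close>
  have "(a \<otimes>\<^bsub>R\<^esub> \<one>\<^bsub>R\<^esub>) s = (\<Oplus>\<^bsub>K\<^esub>g\<in>insert s (supp a).
      a g \<otimes>\<^bsub>K\<^esub> \<one>\<^bsub>R\<^esub> (inv\<^bsub>G\<^esub> g \<otimes>\<^bsub>G\<^esub> s) \<otimes>\<^bsub>K\<^esub> \<phi> (g, inv\<^bsub>G\<^esub> g \<otimes>\<^bsub>G\<^esub> s))"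
    using s finite_supp[OF a] by (intro mult_apply[OF a one_closed s]) auto
  also have "\<dots> = (\<Oplus>\<^bsub>K\<^esub>g\<in>insert s (supp a). if g = s then a g \<otimes>\<^bsub>K\<^esub> inv\<^bsub>K\<^esub> ?u \<otimes>\<^bsub>K\<^esub> ?u else \<zero>\<^bsub>K\<^esub>)"
    using s a by (intro K.finsum_cong') (auto simp: one_apply * factor_one_right[OF s])
  also have "\<dots> = a s \<otimes>\<^bsub>K\<^esub> inv\<^bsub>K\<^esub> ?u \<otimes>\<^bsub>K\<^esub> ?u"
    using s a finite_supp[OF a] by (intro K.add.finprod_singleton_swap) auto
  finally show "(a \<otimes>\<^bsub>R\<^esub> \<one>\<^bsub>R\<^esub>) s = a s"
    using s a by (simp add: K.m_assoc)
qed (use a in \<open>simp_all add: mult_closed one_closed\<close>)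

section \<open>Associativity from the cocycle identity\<close>

text \<open>The left side becomes a double sum over \<open>g\<close> and \<open>u\<close>, where
  \<open>u\<close> is the product of the first two indices. After exchanging the sums, the
  substitution \<open>u = g h\<close> and the cocycle identity turn the inner sum into a coefficient
  of the product of \<open>b\<close> and \<open>c\<close>.\<close>

lemma mult_assoc:
  assumes a: "a \<in> carrier R" and b: "b \<in> carrier R" and c: "c \<in> carrier R"
  shows "(a \<otimes>\<^bsub>R\<^esub> b) \<otimes>\<^bsub>R\<^esub> c = a \<otimes>\<^bsub>R\<^esub> (b \<otimes>\<^bsub>R\<^esub> c)"
proof (rule twisted_eqI)
  fix s assume s: "s \<in> carrier G"
  define A where "A = supp a"
  \<comment> \<open>One range for \<open>u\<close> independent of \<open>g\<close>, so that the sums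
    can be exchanged; it also contains \<open>g h\<close> for all \<open>g\<close> in
    \<open>A\<close> and \<open>h\<close> in the support of \<open>b\<close>.\<close>
  define D where "D = (\<lambda>(g, h). g \<otimes>\<^bsub>G\<^esub> h) ` (supp a \<times> supp b)"
  have A: "finite A" "A \<subseteq> carrier G" "supp a \<subseteq> A"
    and D: "finite D" "D \<subseteq> carrier G" "supp (a \<otimes>\<^bsub>R\<^esub> b) \<subseteq> D"
    using finite_supp[OF a] finite_supp[OF b] supp_mult[OF a b] by (auto simp: A_def D_def)
  have mem: "g \<in> A \<Longrightarrow> g \<in> carrier G" "g \<in> D \<Longrightarrow> g \<in> carrier G" for g
    using A D by auto
  \<comment> \<open>The last two factors are bracketed so that they distribute as a single factor
    over the sum for \<open>a\<close> times \<open>b\<close>.\<close>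
  let ?t = "\<lambda>g u. a g \<otimes>\<^bsub>K\<^esub> b (inv\<^bsub>G\<^esub> g \<otimes>\<^bsub>G\<^esub> u) \<otimes>\<^bsub>K\<^esub> \<phi> (g, inv\<^bsub>G\<^esub> g \<otimes>\<^bsub>G\<^esub> u) \<otimes>\<^bsub>K\<^esub>
    (c (inv\<^bsub>G\<^esub> u \<otimes>\<^bsub>G\<^esub> s) \<otimes>\<^bsub>K\<^esub> \<phi> (u, inv\<^bsub>G\<^esub> u \<otimes>\<^bsub>G\<^esub> s))"
  have t_closed: "?t g u \<in> carrier K" if "g \<in> carrier G" "u \<in> carrier G" for g u
    using that a b c s by simp
  have "((a \<otimes>\<^bsub>R\<^esub> b) \<otimes>\<^bsub>R\<^esub> c) s =
      (\<Oplus>\<^bsub>K\<^esub>u\<in>D. (a \<otimes>\<^bsub>R\<^esub> b) u \<otimes>\<^bsub>K\<^esub> c (inv\<^bsub>G\<^esub> u \<otimes>\<^bsub>G\<^esub> s) \<otimes>\<^bsub>K\<^esub> \<phi> (u, inv\<^bsub>G\<^esub> u \<otimes>\<^bsub>G\<^esub> s))"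
    by (rule mult_apply[OF mult_closed[OF a b] c s D])
  also have "\<dots> = (\<Oplus>\<^bsub>K\<^esub>u\<in>D. \<Oplus>\<^bsub>K\<^esub>g\<in>A. ?t g u)"
  proof (rule K.finsum_cong')
    fix u assume u: "u \<in> D"
    have "(a \<otimes>\<^bsub>R\<^esub> b) u \<otimes>\<^bsub>K\<^esub> c (inv\<^bsub>G\<^esub> u \<otimes>\<^bsub>G\<^esub> s) \<otimes>\<^bsub>K\<^esub> \<phi> (u, inv\<^bsub>G\<^esub> u \<otimes>\<^bsub>G\<^esub> s) =
        (a \<otimes>\<^bsub>R\<^esub> b) u \<otimes>\<^bsub>K\<^esub> (c (inv\<^bsub>G\<^esub> u \<otimes>\<^bsub>G\<^esub> s) \<otimes>\<^bsub>K\<^esub> \<phi> (u, inv\<^bsub>G\<^esub> u \<otimes>\<^bsub>G\<^esub> s))"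
      using u mem s c mult_closed[OF a b] by (simp add: K.m_assoc)
    also have "\<dots> = (\<Oplus>\<^bsub>K\<^esub>g\<in>A. ?t g u)"
      unfolding mult_apply[OF a b mem(2)[OF u] A]
      using A u mem s a b c by (intro K.finsum_ldistr) auto
    finally show "(a \<otimes>\<^bsub>R\<^esub> b) u \<otimes>\<^bsub>K\<^esub> c (inv\<^bsub>G\<^esub> u \<otimes>\<^bsub>G\<^esub> s) \<otimes>\<^bsub>K\<^esub> \<phi> (u, inv\<^bsub>G\<^esub> u \<otimes>\<^bsub>G\<^esub> s) =
      (\<Oplus>\<^bsub>K\<^esub>g\<in>A. ?t g u)" .
  qed (simp_all add: t_closed mem Pi_iff)
  also have "\<dots> = (\<Oplus>\<^bsub>K\<^esub>g\<in>A. \<Oplus>\<^bsub>K\<^esub>u\<in>D. ?t g u)"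
    using D(1) by (intro K.add.finprod_swap) (simp_all add: t_closed mem)
  also have "\<dots> = (\<Oplus>\<^bsub>K\<^esub>g\<in>A. a g \<otimes>\<^bsub>K\<^esub> (b \<otimes>\<^bsub>R\<^esub> c) (inv\<^bsub>G\<^esub> g \<otimes>\<^bsub>G\<^esub> s) \<otimes>\<^bsub>K\<^esub> \<phi> (g, inv\<^bsub>G\<^esub> g \<otimes>\<^bsub>G\<^esub> s))"
  proof (rule K.finsum_cong')
    fix g assume gA: "g \<in> A"
    then have g: "g \<in> carrier G" by (rule mem)
    define r where "r = inv\<^bsub>G\<^esub> g \<otimes>\<^bsub>G\<^esub> s"
    \<comment> \<open>Translating \<open>D\<close> back by \<open>g\<close> gives the range of
      \<open>h\<close> in \<open>u = g h\<close>. It contains the support of \<open>b\<close>, as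
      \<open>mult_apply\<close> requires for the product of \<open>b\<close> and
      \<open>c\<close>.\<close>
    define E where "E = (\<lambda>u. inv\<^bsub>G\<^esub> g \<otimes>\<^bsub>G\<^esub> u) ` D"
    let ?q = "\<lambda>h. b h \<otimes>\<^bsub>K\<^esub> c (inv\<^bsub>G\<^esub> h \<otimes>\<^bsub>G\<^esub> r) \<otimes>\<^bsub>K\<^esub> \<phi> (h, inv\<^bsub>G\<^esub> h \<otimes>\<^bsub>G\<^esub> r)"
    have r: "r \<in> carrier G" and s_eq: "s = g \<otimes>\<^bsub>G\<^esub> r" using s g by (simp_all add: r_def)
    have E: "finite E" "E \<subseteq> carrier G" "supp b \<subseteq> E"
    proof -
      show "finite E" "E \<subseteq> carrier G" using D g mem by (auto simp: E_def)
      show "supp b \<subseteq> E"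
      proof
        fix h assume h: "h \<in> supp b"
        then have "g \<otimes>\<^bsub>G\<^esub> h \<in> D" using gA by (auto simp: D_def A_def)
        then show "h \<in> E" unfolding E_def
          using h g by (intro image_eqI[of _ _ "g \<otimes>\<^bsub>G\<^esub> h"]) auto
      qed
    qed
    have D_eq: "D = (\<lambda>h. g \<otimes>\<^bsub>G\<^esub> h) ` E"
      using g mem by (force simp: E_def image_image)
    have q_closed: "?q h \<in> carrier K" if "h \<in> carrier G" for h
      using that b c r by simp
    have "(\<Oplus>\<^bsub>K\<^esub>u\<in>D. ?t g u) = (\<Oplus>\<^bsub>K\<^esub>h\<in>E. ?t g (g \<otimes>\<^bsub>G\<^esub> h))"
      unfolding D_eq using E g
      by (intro K.finsum_reindex) (auto intro!: t_closed inj_onI simp: subset_iff)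
    also have "\<dots> = (\<Oplus>\<^bsub>K\<^esub>h\<in>E. a g \<otimes>\<^bsub>K\<^esub> \<phi> (g, r) \<otimes>\<^bsub>K\<^esub> ?q h)"
    proof (rule K.finsum_cong')
      fix h assume "h \<in> E"
      then have h: "h \<in> carrier G" using E by auto
      let ?w = "inv\<^bsub>G\<^esub> h \<otimes>\<^bsub>G\<^esub> r"
      have w: "?w \<in> carrier G" "inv\<^bsub>G\<^esub> (g \<otimes>\<^bsub>G\<^esub> h) \<otimes>\<^bsub>G\<^esub> s = ?w"
        using g h r by (simp_all add: s_eq G.inv_mult_group G.m_assoc)
      \<comment> \<open>The cocycle identity at \<open>(g, h, ?w)\<close>, where \<open>h\<close>
        times \<open>?w\<close> is \<open>r\<close>.\<close>
      have "\<phi> (h, ?w) \<otimes>\<^bsub>K\<^esub> \<phi> (g, r) = \<phi> (g, h) \<otimes>\<^bsub>K\<^esub> \<phi> (g \<otimes>\<^bsub>G\<^esub> h, ?w)"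
        using cocycle[OF g h w(1)] h r by simp
      moreover have "?t g (g \<otimes>\<^bsub>G\<^esub> h) = a g \<otimes>\<^bsub>K\<^esub> (b h \<otimes>\<^bsub>K\<^esub> (c ?w \<otimes>\<^bsub>K\<^esub> (\<phi> (g, h) \<otimes>\<^bsub>K\<^esub> \<phi> (g \<otimes>\<^bsub>G\<^esub> h, ?w))))"
        using g h w a b c by (simp add: K.m_ac)
      moreover have "a g \<otimes>\<^bsub>K\<^esub> \<phi> (g, r) \<otimes>\<^bsub>K\<^esub> ?q h = a g \<otimes>\<^bsub>K\<^esub> (b h \<otimes>\<^bsub>K\<^esub> (c ?w \<otimes>\<^bsub>K\<^esub> (\<phi> (h, ?w) \<otimes>\<^bsub>K\<^esub> \<phi> (g, r))))"
        using g h w r a b c by (simp add: K.m_ac)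
      ultimately show "?t g (g \<otimes>\<^bsub>G\<^esub> h) = a g \<otimes>\<^bsub>K\<^esub> \<phi> (g, r) \<otimes>\<^bsub>K\<^esub> ?q h" by simp
    qed (use E g r a q_closed in \<open>auto simp: subset_iff\<close>)
    also have "\<dots> = a g \<otimes>\<^bsub>K\<^esub> \<phi> (g, r) \<otimes>\<^bsub>K\<^esub> (b \<otimes>\<^bsub>R\<^esub> c) r"
      unfolding mult_apply[OF b c r E] using E g r a q_closed
      by (intro K.finsum_rdistr[symmetric]) (auto simp: subset_iff)
    also have "\<dots> = a g \<otimes>\<^bsub>K\<^esub> (b \<otimes>\<^bsub>R\<^esub> c) r \<otimes>\<^bsub>K\<^esub> \<phi> (g, r)"
      using g r a mult_closed[OF b c] by (simp add: K.m_ac)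
    finally show "(\<Oplus>\<^bsub>K\<^esub>u\<in>D. ?t g u) =
        a g \<otimes>\<^bsub>K\<^esub> (b \<otimes>\<^bsub>R\<^esub> c) (inv\<^bsub>G\<^esub> g \<otimes>\<^bsub>G\<^esub> s) \<otimes>\<^bsub>K\<^esub> \<phi> (g, inv\<^bsub>G\<^esub> g \<otimes>\<^bsub>G\<^esub> s)"
      by (simp add: r_def)
  qed (use mem s a mult_closed[OF b c] in auto)
  also have "\<dots> = (a \<otimes>\<^bsub>R\<^esub> (b \<otimes>\<^bsub>R\<^esub> c)) s"
    by (rule mult_apply[OF a mult_closed[OF b c] s A, symmetric])
  finally show "((a \<otimes>\<^bsub>R\<^esub> b) \<otimes>\<^bsub>R\<^esub> c) s = (a \<otimes>\<^bsub>R\<^esub> (b \<otimes>\<^bsub>R\<^esub> c)) s" .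
qed (use a b c in \<open>simp_all add: mult_closed\<close>)

section \<open>Ring axioms\<close>

lemma ring_twisted: "ring R"
proof -
  interpret R: abelian_group R by (rule abelian_group_twisted)
  show ?thesis
  proof (rule ringI)
    show "abelian_group R" by (rule abelian_group_twisted)
    show "monoid R"
      by (rule monoidI) (simp_all add: mult_closed one_closed mult_assoc one_mult mult_one)
    fix x y z assume x: "x \<in> carrier R" and y: "y \<in> carrier R" and z: "z \<in> carrier R"
    note xy = R.a_closed[OF x y]
    show "(x \<oplus>\<^bsub>R\<^esub> y) \<otimes>\<^bsub>R\<^esub> z = x \<otimes>\<^bsub>R\<^esub> z \<oplus>\<^bsub>R\<^esub> y \<otimes>\<^bsub>R\<^esub> z"
    proof (rule twisted_eqI)
      fix s assume s: "s \<in> carrier G"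
      \<comment> \<open>A common index set for all three products: it contains the supports of
        \<open>x\<close>, of \<open>y\<close> and of their sum, so the sums can be added
        termwise.\<close>
      let ?A = "supp x \<union> supp y"
      have A: "finite ?A" "?A \<subseteq> carrier G" "supp x \<subseteq> ?A" "supp y \<subseteq> ?A" "supp (x \<oplus>\<^bsub>R\<^esub> y) \<subseteq> ?A"
        using finite_supp[OF x] finite_supp[OF y] by auto
      show "((x \<oplus>\<^bsub>R\<^esub> y) \<otimes>\<^bsub>R\<^esub> z) s = (x \<otimes>\<^bsub>R\<^esub> z \<oplus>\<^bsub>R\<^esub> y \<otimes>\<^bsub>R\<^esub> z) s"
        unfolding add_apply[OF s] mult_apply[OF xy z s A(1,2,5)] mult_apply[OF x z s A(1-3)]
          mult_apply[OF y z s A(1,2,4)]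
        using x y z s
        by (subst K.finsum_addf[symmetric]) (auto intro!: K.finsum_cong' simp: K.l_distr simp del: K.finsum_addf)
    qed (use x y z in \<open>simp_all add: mult_closed\<close>)
    show "z \<otimes>\<^bsub>R\<^esub> (x \<oplus>\<^bsub>R\<^esub> y) = z \<otimes>\<^bsub>R\<^esub> x \<oplus>\<^bsub>R\<^esub> z \<otimes>\<^bsub>R\<^esub> y"
    proof (rule twisted_eqI)
      fix s assume s: "s \<in> carrier G"
      \<comment> \<open>Here all three products have the same left factor \<open>z\<close>, so its
        support already serves as the common index set.\<close>
      have A: "finite (supp z)" "supp z \<subseteq> carrier G" "supp z \<subseteq> supp z"
        using finite_supp[OF z] by auto
      show "(z \<otimes>\<^bsub>R\<^esub> (x \<oplus>\<^bsub>R\<^esub> y)) s = (z \<otimes>\<^bsub>R\<^esub> x \<oplus>\<^bsub>R\<^esub> z \<otimes>\<^bsub>R\<^esub> y) s"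
        unfolding add_apply[OF s] mult_apply[OF z xy s A] mult_apply[OF z x s A]
          mult_apply[OF z y s A]
        using x y z s
        by (subst K.finsum_addf[symmetric]) (auto intro!: K.finsum_cong' simp: K.l_distr K.r_distr simp del: K.finsum_addf)
    qed (use x y z in \<open>simp_all add: mult_closed\<close>)
  qed
qed

section \<open>Commutativity of the ring and symmetry of the cocycle\<close>

text \<open>The defining sum over pairs is used here, because exchanging the entries of a pair
  preserves its product in an abelian group. This reindexes one product as the other, and symmetry
  of \<open>\<phi>\<close> matches the terms.\<close>

lemma cring_twisted_if_symmetric:
  assumes "comm_group G" and sym: "symmetric_cochain G \<phi>"
  shows "cring R"
proof -
  interpret G: comm_group G by fact
  interpret R: ring R by (rule ring_twisted)
  have "a \<otimes>\<^bsub>R\<^esub> b = b \<otimes>\<^bsub>R\<^esub> a" if a: "a \<in> carrier R" and b: "b \<in> carrier R" for a b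
  proof (rule twisted_eqI)
    fix s assume s: "s \<in> carrier G"
    let ?S = "\<lambda>a b. {(g, h) \<in> carrier G \<times> carrier G. a g \<noteq> \<zero>\<^bsub>K\<^esub> \<and> b h \<noteq> \<zero>\<^bsub>K\<^esub> \<and> g \<otimes>\<^bsub>G\<^esub> h = s}"
    let ?F = "\<lambda>a b (g, h). a g \<otimes>\<^bsub>K\<^esub> b h \<otimes>\<^bsub>K\<^esub> \<phi> (g, h)"
    have S: "?S a b = prod.swap ` ?S b a"
      by (auto simp: G.m_comm image_iff)
    have "(a \<otimes>\<^bsub>R\<^esub> b) s = finsum K (?F a b) (?S a b)"
      using s by (simp add: twisted_group_ring_def)
    also have "\<dots> = (\<Oplus>\<^bsub>K\<^esub>p\<in>?S b a. ?F a b (prod.swap p))"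
      unfolding S using a b by (intro K.finsum_reindex) (auto simp: inj_on_def)
    also have "\<dots> = finsum K (?F b a) (?S b a)"
      using a b sym by (intro K.finsum_cong') (auto simp: symmetric_cochain_def K.m_comm)
    also have "\<dots> = (b \<otimes>\<^bsub>R\<^esub> a) s"
      using s by (simp add: twisted_group_ring_def)
    finally show "(a \<otimes>\<^bsub>R\<^esub> b) s = (b \<otimes>\<^bsub>R\<^esub> a) s" .
  qed (use a b in simp_all)
  then show ?thesis
    by (intro cring.intro comm_monoid.intro comm_monoid_axioms.intro R.ring_axioms R.monoid_axioms)
qed

lemma symmetric_if_cring_twisted:
  assumes "comm_group G" "field K" and R: "cring R"
  shows "symmetric_cochain G \<phi>"
  unfolding symmetric_cochain_def
proof (intro ballI)
  fix g h assume g: "g \<in> carrier G" and h: "h \<in> carrier G"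
  let ?x = "monomial K G \<one>\<^bsub>K\<^esub>"
  interpret G: comm_group G by fact
  have mult: "(?x f \<otimes>\<^bsub>R\<^esub> ?x f') (f \<otimes>\<^bsub>G\<^esub> f') = \<phi> (f, f')" if "f \<in> carrier G" "f' \<in> carrier G" for f f'
    using that assms(2)
    by (subst monomial_mult[OF G.is_group]) (auto simp: monomial_def)
  have "?x g \<otimes>\<^bsub>R\<^esub> ?x h = ?x h \<otimes>\<^bsub>R\<^esub> ?x g"
    using monomial_closed[OF assms(2) g K.one_closed] monomial_closed[OF assms(2) h K.one_closed]
    by (rule comm_monoid.m_comm[OF cring.axioms(2)[OF R]])
  then show "\<phi> (g, h) = \<phi> (h, g)"
    using mult[OF g h] mult[OF h g] g h by (simp add: G.m_comm)
qed

end

section \<open>Cohomology classes and their representatives\<close>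

text \<open>The group \<open>units_of K\<close> has carrier \<open>Units K\<close> and the
  multiplication of \<open>K\<close>, so \<open>Z2_iff\<close> supplies the inverse-free cocycle
  identity inside \<open>K\<close>.\<close>

lemma factor_set_Z2:
  assumes "comm_group G" "cring K" "\<phi> \<in> Z2 G (units_of K)"
  shows "factor_set G K \<phi>"
proof -
  interpret G: comm_group G by fact
  interpret K: cring K by fact
  have A: "comm_group (units_of K)" by (rule K.units_comm_group)
  have "\<phi> (g, h) \<in> Units K" if "g \<in> carrier G" "h \<in> carrier G" for g h
    using C2_mem[OF assms(1) A _ that] assms(3)
    by (simp add: Z2_def units_of_carrier)
  then show ?thesis
    using assms(3) unfolding Z2_iff[OF assms(1) A]
    by unfold_locales (simp_all add: units_of_mult)
qed

text \<open>Coboundaries are cocycles, so a coset of one cocycle consists of cocycles; and a coset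
  is the coset of each of its members. Thus any \<open>\<phi>\<close> in \<open>c\<close> serves as
  representative.\<close>

lemma H2_class:
  assumes G: "comm_group G" and A: "comm_group A"
    and c: "c \<in> carrier (H2 G A)" and \<phi>: "\<phi> \<in> c"
  shows "\<phi> \<in> Z2 G A" and "c = B2 G A #>\<^bsub>C2 G A\<^esub> \<phi>"
proof -
  interpret C: comm_group "C2 G A" by (rule comm_group_C2[OF G A])
  obtain \<psi> where \<psi>: "\<psi> \<in> Z2 G A" "c = B2 G A #>\<^bsub>C2 G A\<^esub> \<psi>"
    using c by (auto simp: H2_def carrier_FactGroup r_coset_def)
  show "\<phi> \<in> Z2 G A"
    using \<phi> \<psi> B2_subset_Z2[OF G A] subgroup.m_closed[OF subgroup_Z2[OF G A]]
    by (auto simp: r_coset_def)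
  show "c = B2 G A #>\<^bsub>C2 G A\<^esub> \<phi>"
    unfolding \<psi>(2)
  proof (rule C.repr_independence)
    show "\<phi> \<in> B2 G A #>\<^bsub>C2 G A\<^esub> \<psi>" using \<phi> \<psi>(2) by simp
    show "\<psi> \<in> carrier (C2 G A)" using \<psi>(1) by (simp add: Z2_def)
  qed (rule subgroup_B2[OF G A])
qed

text \<open>Forwards, \<open>\<phi>\<close> is the product of a symmetric coboundary and a symmetric
  cocycle. Backwards, \<open>B2S\<close> equals \<open>B2\<close>, so the class of a symmetric
  \<open>\<phi>\<close> is literally a coset of \<open>B2S\<close>.\<close>

lemma H2S_iff_symmetric:
  assumes G: "comm_group G" and A: "comm_group A"
    and c: "c \<in> carrier (H2 G A)" and \<phi>: "\<phi> \<in> c"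
  shows "c \<in> carrier (H2S G A) \<longleftrightarrow> symmetric_cochain G \<phi>"
proof
  assume "c \<in> carrier (H2S G A)"
  then obtain \<psi> where \<psi>: "\<psi> \<in> Z2S G A" "c = B2S G A #>\<^bsub>C2 G A\<^esub> \<psi>"
    by (auto simp: H2S_def carrier_FactGroup r_coset_def)
  then obtain \<beta> where \<beta>: "\<beta> \<in> B2S G A" and \<phi>_eq: "\<phi> = \<beta> \<otimes>\<^bsub>C2 G A\<^esub> \<psi>"
    using \<phi> by (auto simp: r_coset_def)
  show "symmetric_cochain G \<phi>"
    using \<psi>(1) \<beta> by (simp add: \<phi>_eq symmetric_cochain_def Z2S_def B2S_def C2_mult[OF G A])
next
  assume "symmetric_cochain G \<phi>"
  then have "\<phi> \<in> Z2S G A"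
    using H2_class[OF assms] by (simp add: Z2S_def)
  then show "c \<in> carrier (H2S G A)"
    using H2_class(2)[OF assms]
    by (auto simp: H2S_def carrier_FactGroup r_coset_def B2S_eq_B2[OF G A])
qed

theorem theorem5p12:
  fixes G :: "('g, 'm) monoid_scheme"
    and K :: "('k, 'n) ring_scheme"
    and c :: "('g \<times> 'g \<Rightarrow> 'k) set"
    and \<phi> :: "'g \<times> 'g \<Rightarrow> 'k"
  assumes "comm_group G"
    and "field K"
    and "c \<in> carrier (H2 G (units_of K))"
    and "\<phi> \<in> c"
  shows "cring (twisted_group_ring K G \<phi>) \<longleftrightarrow> c \<in> carrier (H2S G (units_of K))"
proof -
  interpret K: field K by fact
  note A = K.units_comm_group
  interpret factor_set G K \<phi>
    using H2_class(1)[OF assms(1) A assms(3,4)] by (rule factor_set_Z2[OF assms(1) K.is_cring])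
  show ?thesis
    unfolding H2S_iff_symmetric[OF assms(1) A assms(3,4)]
    using cring_twisted_if_symmetric symmetric_if_cring_twisted assms(1,2) by blast
qed

end
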